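(* For every $0\le\varepsilon<1$ and every $M>0$ there is an instance of the correlated prophet inequality with $n=2$ rewards, i.e. a distribution $F$ over $\mathbb{R}_{\ge0}^2$, for which every block threshold algorithm has $(1-\varepsilon)$-competition complexity at least $M$.
   Context: Let $F$ be a known joint distribution over $v=(v_1,\dots,v_n)\in\mathbb{R}_{\ge0}^n$ (arbitrary correlations allowed). Given $k$ i.i.d. copies $v^{(1)},\dots,v^{(k)}\sim F$, the $nk$ rewards are revealed one by one in the order $v^{(1)}_1,\dots,v^{(1)}_n,v^{(2)}_1,\dots,v^{(k)}_n$ (block arrival), and an online algorithm irrevocably selects at most one reward; $\mathrm{ALG}(v)$ is the selected value ($0$ if none). A block threshold algorithm sets, for each number $k$ of copies, a threshold $\tau_t$ for each copy $t\in[k]$ (thresholds may differ between copies and may depend on $F$ and $k$) and selects the first arriving reward $v^{(t)}_i$ with $v^{(t)}_i\ge\tau_t$. The $(1-\varepsilon)$-competition complexity of $\mathrm{ALG}$ on the instance $F$ is the smallest positive integer $k_0$ such that for every $k\ge k_0$, $\mathbb{E}_{v\sim F^k}[\mathrm{ALG}(v)]\ge(1-\varepsilon)\,\mathbb{E}_{v\sim F}[\max_i v_i]$ (and $\infty$ if no such $k_0$ exists). *)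

theory Defs
  imports "HOL-Probability.Probability"
begin

text \<open>
  The rewards of one copy are a vector \<open>v\<close> in \<open>\<Pi>\<^sub>M i\<in>{..<n}. borel\<close>; the rewards of \<open>k\<close> copies are
  \<open>v t i\<close> with copy \<open>t < k\<close> and position \<open>i < n\<close>, both counted from 0.

  The rewards are required to be integrable, so that the Bochner integrals used as expectations
  below are the true expectations and not the default value 0.
\<close>

definition correlated_prophet_instance :: "nat \<Rightarrow> (nat \<Rightarrow> real) measure \<Rightarrow> bool" where
  "correlated_prophet_instance n F \<longleftrightarrow>
     prob_space F \<and>
     sets F = sets (\<Pi>\<^sub>M i\<in>{..<n}. (borel :: real measure)) \<and>
     (AE v in F. \<forall>i<n. 0 \<le> v i) \<and>
     (\<forall>i<n. integrable F (\<lambda>v. v i))"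

definition iid_copies :: "nat \<Rightarrow> 'a measure \<Rightarrow> (nat \<Rightarrow> 'a) measure" where
  "iid_copies k F = (\<Pi>\<^sub>M t\<in>{..<k}. F)"

text \<open>Block arrival: \<^const>\<open>List.product\<close> enumerates the pairs \<open>(t, i)\<close> lexicographically.\<close>

definition arrival_order :: "nat \<Rightarrow> nat \<Rightarrow> (nat \<times> nat) list" where
  "arrival_order n k = List.product [0..<k] [0..<n]"

text \<open>An algorithm is represented by its selected value, as a function of \<open>k\<close> and of the rewards of
  the \<open>k\<close> copies. Below, \<open>\<tau> k t\<close> is the threshold for copy \<open>t\<close> when there are \<open>k\<close> copies.\<close>

definition block_threshold_alg ::
    "nat \<Rightarrow> (nat \<Rightarrow> nat \<Rightarrow> real) \<Rightarrow> nat \<Rightarrow> (nat \<Rightarrow> nat \<Rightarrow> real) \<Rightarrow> real" where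
  "block_threshold_alg n \<tau> k v =
     (case find (\<lambda>(t, i). \<tau> k t \<le> v t i) (arrival_order n k) of
        None \<Rightarrow> 0
      | Some (t, i) \<Rightarrow> v t i)"

text \<open>On \<^typ>\<open>enat\<close> the infimum of a nonempty set is its least element, and that of the empty set
  is \<open>\<infinity>\<close>.\<close>

definition competition_complexity ::
    "real \<Rightarrow> nat \<Rightarrow> (nat \<Rightarrow> real) measure \<Rightarrow> (nat \<Rightarrow> (nat \<Rightarrow> nat \<Rightarrow> real) \<Rightarrow> real) \<Rightarrow> enat" where
  "competition_complexity \<epsilon> n F ALG =
     Inf (enat ` {k\<^sub>0. 1 \<le> k\<^sub>0 \<and>
       (\<forall>k\<ge>k\<^sub>0. (1 - \<epsilon>) * (\<integral>v. Max (v ` {..<n}) \<partial>F) \<le> (\<integral>v. ALG k v \<partial>iid_copies k F))})"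

end

theory Submission
  imports Defs
begin

text \<open>
  The selected value is at most the sum over the copies of what each threshold selects within its
  own copy, so \<open>k\<close> copies gain at most a factor \<open>k\<close> over the best threshold on a single copy. A
  single threshold can be arbitrarily bad: with probability proportional to \<open>N\<^sup>-\<^sup>j\<close>, \<open>j < N\<close>, let the
  rewards be \<open>(N\<^sup>j, N\<^sup>j\<^sup>+\<^sup>1)\<close>. Each \<open>j\<close> contributes \<open>N\<close> to the expected maximum, up to normalization.
  A threshold \<open>\<theta>\<close> obtains the second reward only for the single \<open>j\<close> with \<open>N\<^sup>j < \<theta> \<le> N\<^sup>j\<^sup>+\<^sup>1\<close>; every
  other \<open>j\<close> contributes at most 1. The ratio is thus at most \<open>2N / N\<^sup>2\<close>.
\<close>

definition block_select :: "nat \<Rightarrow> real \<Rightarrow> (nat \<Rightarrow> real) \<Rightarrow> real" where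
  "block_select n \<theta> w =
     (case find (\<lambda>i. \<theta> \<le> w i) [0..<n] of None \<Rightarrow> 0 | Some i \<Rightarrow> w i)"

lemma find_append: "find P (xs @ ys) = (case find P xs of None \<Rightarrow> find P ys | Some x \<Rightarrow> Some x)"
  by (induction xs) auto

lemma find_map: "find P (map f xs) = map_option f (find (P \<circ> f) xs)"
  by (induction xs) auto

text \<open>The product list is a concatenation of blocks with constant first component, and
  \<open>find\<close> enters a block only after all earlier ones have failed, so the first hit
  overall is the first hit within its block.\<close>

lemma find_product_SomeD:
  assumes "find P (List.product xs ys) = Some (x, y)"
  shows "x \<in> set xs \<and> find (\<lambda>y. P (x, y)) ys = Some y"
  using assms
  by (induction xs) (auto simp: find_append find_map comp_def split: option.splits)

text \<open>The selected value is 0 or one of the values summed. The absolute values keep the other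
  summands from lowering the sum, as \<open>v\<close> is arbitrary here.\<close>

lemma block_threshold_alg_le_sum:
  "block_threshold_alg n \<tau> k v \<le> (\<Sum>t<k. \<bar>block_select n (\<tau> k t) (v t)\<bar>)"
proof (cases "find (\<lambda>(t, i). \<tau> k t \<le> v t i) (arrival_order n k)")
  case None
  then show ?thesis
    by (simp add: block_threshold_alg_def sum_nonneg)
next
  case (Some p)
  obtain t i where p: "p = (t, i)" by (cases p)
  have t: "t < k" and "find (\<lambda>i. \<tau> k t \<le> v t i) [0..<n] = Some i"
    using find_product_SomeD[OF Some[unfolded p arrival_order_def]] by auto
  then have "block_threshold_alg n \<tau> k v \<le> \<bar>block_select n (\<tau> k t) (v t)\<bar>"
    using Some p by (simp add: block_threshold_alg_def block_select_def)
  also have "\<dots> \<le> (\<Sum>t<k. \<bar>block_select n (\<tau> k t) (v t)\<bar>)"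
    using t by (intro member_le_sum) auto
  finally show ?thesis .
qed

lemma expectation_block_threshold_alg_le:
  assumes "prob_space F"
    and int: "\<And>\<theta>. integrable F (block_select n \<theta>)"
    and le: "\<And>\<theta>. (\<integral>w. \<bar>block_select n \<theta> w\<bar> \<partial>F) \<le> B"
  shows "(\<integral>v. block_threshold_alg n \<tau> k v \<partial>iid_copies k F) \<le> real k * B"
proof -
  interpret prob_space F by fact
  have comp: "distr (iid_copies k F) F (\<lambda>v. v t) = F" if "t < k" for t
    using that unfolding iid_copies_def
    by (intro distr_PiM_component) (auto intro: prob_space_axioms)
  have meas: "(\<lambda>v. v t) \<in> measurable (iid_copies k F) F" if "t < k" for t
    using that unfolding iid_copies_def by (intro measurable_component_singleton) auto
  have int': "integrable (iid_copies k F) (\<lambda>v. \<bar>block_select n \<theta> (v t)\<bar>)" if "t < k" for t \<theta>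
    by (rule integrable_distr[OF meas[OF that]]) (simp add: comp[OF that] int)
  have eq: "(\<integral>v. \<bar>block_select n \<theta> (v t)\<bar> \<partial>iid_copies k F) = (\<integral>w. \<bar>block_select n \<theta> w\<bar> \<partial>F)"
    if "t < k" for t \<theta>
    using integral_distr[OF meas[OF that], of "\<lambda>w. \<bar>block_select n \<theta> w\<bar>"] int
    by (simp add: comp[OF that])
  have "(\<integral>v. block_threshold_alg n \<tau> k v \<partial>iid_copies k F) \<le>
        (\<integral>v. (\<Sum>t<k. \<bar>block_select n (\<tau> k t) (v t)\<bar>) \<partial>iid_copies k F)"
    \<comment> \<open>Here \<open>integral_mono'\<close> asks only the dominating sum to be
      integrable and nonnegative: a non-integrable left side would have integral 0.\<close>
    using int' by (intro integral_mono' block_threshold_alg_le_sum sum_nonneg) auto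
  also have "\<dots> = (\<Sum>t<k. \<integral>w. \<bar>block_select n (\<tau> k t) w\<bar> \<partial>F)"
    using int' by (subst Bochner_Integration.integral_sum) (auto simp: eq)
  also have "\<dots> \<le> real k * B"
    using sum_bounded_above[of "{..<k}" "\<lambda>t. \<integral>w. \<bar>block_select n (\<tau> k t) w\<bar> \<partial>F" B] le by simp
  finally show ?thesis .
qed

text \<open>One failure at \<open>K\<close> suffices: an admissible \<open>k\<^sub>0\<close> needs
  the inequality at every \<open>k\<close> from \<open>k\<^sub>0\<close> on, so it must exceed
  \<open>K\<close>.\<close>

lemma competition_complexity_ge:
  assumes "(\<integral>v. ALG K v \<partial>iid_copies K F) < (1 - \<epsilon>) * (\<integral>v. Max (v ` {..<n}) \<partial>F)"
  shows "enat K \<le> competition_complexity \<epsilon> n F ALG"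
  unfolding competition_complexity_def
proof (rule Inf_greatest)
  fix x
  assume "x \<in> enat ` {k\<^sub>0. 1 \<le> k\<^sub>0 \<and>
    (\<forall>k\<ge>k\<^sub>0. (1 - \<epsilon>) * (\<integral>v. Max (v ` {..<n}) \<partial>F) \<le> (\<integral>v. ALG k v \<partial>iid_copies k F))}"
  then obtain k\<^sub>0 where "x = enat k\<^sub>0" and
    "\<forall>k\<ge>k\<^sub>0. (1 - \<epsilon>) * (\<integral>v. Max (v ` {..<n}) \<partial>F) \<le> (\<integral>v. ALG k v \<partial>iid_copies k F)"
    by auto
  with assms have "\<not> k\<^sub>0 \<le> K" by (meson not_le)
  with \<open>x = enat k\<^sub>0\<close> show "enat K \<le> x" by simp
qed

lemma block_select_2:
  "block_select 2 \<theta> w = (if \<theta> \<le> w 0 then w 0 else if \<theta> \<le> w 1 then w 1 else 0)"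
  by (simp add: block_select_def numeral_2_eq_2)

lemma measurable_coordinates_2 [measurable]:
  "(\<lambda>w. w 0) \<in> borel_measurable (\<Pi>\<^sub>M i\<in>{..<2 :: nat}. (borel :: real measure))"
  "(\<lambda>w. w 1) \<in> borel_measurable (\<Pi>\<^sub>M i\<in>{..<2 :: nat}. (borel :: real measure))"
  by (auto intro!: measurable_component_singleton)

lemma measurable_block_select_2 [measurable]:
  "block_select 2 \<theta> \<in> borel_measurable (\<Pi>\<^sub>M i\<in>{..<2}. borel)"
  unfolding block_select_2[abs_def] by measurable

text \<open>The mass at \<open>j \<ge> N\<close> gets reward 0, so a geometric distribution serves
  without renormalization and expectations become finite sums. Restricting to \<open>{..<2}\<close>
  puts the vector into the product space, whose elements are extensional.\<close>

definition geometric_rewards :: "nat \<Rightarrow> nat \<Rightarrow> nat \<Rightarrow> real" where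
  "geometric_rewards N j = (\<lambda>i\<in>{..<2}. if j < N then real N ^ (j + i) else 0)"

text \<open>The geometric distribution gives \<open>j\<close> the probability \<open>(1 - 1/N) N\<^sup>-\<^sup>j\<close>.\<close>

definition geometric_instance :: "nat \<Rightarrow> (nat \<Rightarrow> real) measure" where
  "geometric_instance N =
     distr (measure_pmf (geometric_pmf (1 - 1 / real N))) (\<Pi>\<^sub>M i\<in>{..<2}. borel)
       (geometric_rewards N)"

lemma geometric_rewards_in_space [simp]:
  "geometric_rewards N j \<in> space (\<Pi>\<^sub>M i\<in>{..<2}. borel)"
  by (simp add: geometric_rewards_def space_PiM)

context
  fixes N :: nat
  assumes N: "2 \<le> N"
begin

lemma integrable_geometric_instance:
  assumes [measurable]: "f \<in> borel_measurable (\<Pi>\<^sub>M i\<in>{..<2}. borel)"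
    and "\<And>j. N \<le> j \<Longrightarrow> f (geometric_rewards N j) = (0 :: real)"
  shows "integrable (geometric_instance N) f"
  unfolding geometric_instance_def
proof (subst integrable_distr_eq)
  \<comment> \<open>Only finitely many values are nonzero, so the sum of their absolute values is a
    uniform bound.\<close>
  have "\<bar>f (geometric_rewards N j)\<bar> \<le> (\<Sum>j<N. \<bar>f (geometric_rewards N j)\<bar>)" for j
    using assms(2)[of j]
    by (cases "j < N") (auto intro: member_le_sum sum_nonneg)
  then show "integrable (geometric_pmf (1 - 1 / real N)) (\<lambda>j. f (geometric_rewards N j))"
    by (intro measure_pmf.integrable_const_bound) auto
qed auto

lemma integral_geometric_instance:
  assumes [measurable]: "f \<in> borel_measurable (\<Pi>\<^sub>M i\<in>{..<2}. borel)"
    and "\<And>j. N \<le> j \<Longrightarrow> f (geometric_rewards N j) = (0 :: real)"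
  shows "(\<integral>w. f w \<partial>geometric_instance N) =
    (1 - 1 / real N) * (\<Sum>j<N. f (geometric_rewards N j) / real N ^ j)"
proof -
  have "(\<integral>w. f w \<partial>geometric_instance N) =
      (\<integral>j. f (geometric_rewards N j) \<partial>geometric_pmf (1 - 1 / real N))"
    unfolding geometric_instance_def by (subst integral_distr) auto
  also have "\<dots> = (\<Sum>j<N. f (geometric_rewards N j) * pmf (geometric_pmf (1 - 1 / real N)) j)"
    using assms(2) by (intro integral_measure_pmf_real) (auto simp: not_le[symmetric])
  also have "\<dots> = (1 - 1 / real N) * (\<Sum>j<N. f (geometric_rewards N j) / real N ^ j)"
    \<comment> \<open>With \<open>p = 1 - 1/N\<close> the mass at \<open>j\<close> is
      \<open>(1 - p)^j * p\<close>; \<open>2 \<le> N\<close> ensures \<open>0 < p\<close>.\<close>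
    using N by (simp add: sum_distrib_left power_divide mult_ac)
  finally show ?thesis .
qed

lemma correlated_prophet_instance_geometric:
  "correlated_prophet_instance 2 (geometric_instance N)"
proof -
  have "prob_space (geometric_instance N)"
    unfolding geometric_instance_def by (intro measure_pmf.prob_space_distr) auto
  moreover have "AE v in geometric_instance N. 0 \<le> v 0 \<and> 0 \<le> v 1"
    unfolding geometric_instance_def
    by (subst AE_distr_iff) (auto simp: geometric_rewards_def space_PiM)
  then have "AE v in geometric_instance N. \<forall>i<2. 0 \<le> v i"
    by eventually_elim (simp add: numeral_2_eq_2 less_Suc_eq)
  moreover have "integrable (geometric_instance N) (\<lambda>v. v i)" if "i < 2" for i
    using that
    by (intro integrable_geometric_instance measurable_component_singleton)
       (auto simp: geometric_rewards_def)
  moreover have "sets (geometric_instance N) = sets (\<Pi>\<^sub>M i\<in>{..<2}. borel)"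
    by (simp add: geometric_instance_def)
  ultimately show ?thesis
    by (simp add: correlated_prophet_instance_def)
qed

lemma expectation_Max_geometric_instance:
  "(\<integral>v. Max (v ` {..<2}) \<partial>geometric_instance N) = (1 - 1 / real N) * (real N)\<^sup>2"
proof -
  have Max_eq: "Max (v ` {..<2}) = max (v 0) (v 1)" for v :: "nat \<Rightarrow> real"
    by (simp add: numeral_2_eq_2 lessThan_Suc max.commute)
  have "(\<Sum>j<N. max (geometric_rewards N j 0) (geometric_rewards N j 1) / real N ^ j) =
      (\<Sum>j<N. real N)"
    using N by (intro sum.cong) (auto simp: geometric_rewards_def max_def)
  then show ?thesis
    unfolding Max_eq
    by (subst integral_geometric_instance) (auto simp: geometric_rewards_def power2_eq_square)
qed

lemma integrable_block_select_geometric: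
  "integrable (geometric_instance N) (block_select 2 \<theta>)"
  by (intro integrable_geometric_instance) (auto simp: block_select_2 geometric_rewards_def)

lemma expectation_block_select_geometric_le:
  "(\<integral>w. \<bar>block_select 2 \<theta> w\<bar> \<partial>geometric_instance N) \<le> (1 - 1 / real N) * (2 * real N)"
proof -
  \<comment> \<open>\<open>J\<close> collects the \<open>j\<close> for which the first reward is
    passed over and the second accepted. The intervals from \<open>N^j\<close> (excluded) to
    \<open>N^(j+1)\<close> (included) are disjoint, so at most one contains
    \<open>\<theta>\<close>.\<close>
  define J where "J = {j \<in> {..<N}. real N ^ j < \<theta> \<and> \<theta> \<le> real N ^ (j + 1)}"
  have "i = j" if "i \<in> J" "j \<in> J" for i j
  proof -
    have "real N ^ i < real N ^ (j + 1)" "real N ^ j < real N ^ (i + 1)"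
      using that by (auto simp: J_def)
    then have "i < j + 1" "j < i + 1"
      using N by (simp_all only: power_strict_increasing_iff)
    then show ?thesis by simp
  qed
  then have "card J \<le> 1"
    using card_le_Suc0_iff_eq[of J] by (auto simp: J_def)
  \<comment> \<open>After division by \<open>N^j\<close> the selected value is \<open>N\<close> for
    \<open>j\<close> in \<open>J\<close>, and otherwise 1 (first reward) or 0 (none).\<close>
  have "(\<Sum>j<N. \<bar>block_select 2 \<theta> (geometric_rewards N j)\<bar> / real N ^ j)
      \<le> (\<Sum>j<N. 1 + (if j \<in> J then real N else 0))"
    using N by (intro sum_mono) (auto simp: J_def block_select_2 geometric_rewards_def)
  also have "\<dots> = real N + real N * real (card J)"
    by (simp add: sum.distrib J_def flip: sum.inter_filter)
  also have "\<dots> \<le> 2 * real N"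
    using mult_left_mono[of "real (card J)" 1 "real N"] \<open>card J \<le> 1\<close> by simp
  finally show ?thesis
    using N
    by (subst integral_geometric_instance)
       (auto simp: block_select_2 geometric_rewards_def intro!: mult_left_mono)
qed

end

theorem proposition6p3:
  fixes \<epsilon> M :: real
  assumes "0 \<le> \<epsilon>" and "\<epsilon> < 1" and "0 < M"
  shows "\<exists>F. correlated_prophet_instance 2 F \<and>
           (\<forall>\<tau>. ereal M \<le> ereal_of_enat
                  (competition_complexity \<epsilon> 2 F (block_threshold_alg 2 \<tau>)))"
proof -
  obtain K :: nat where K: "M \<le> real K"
    using real_arch_simple by blast
  \<comment> \<open>This makes the bound \<open>2 * K * N\<close> fall below
    \<open>(1 - \<epsilon>) * N^2\<close>, up to the common factor \<open>1 - 1/N\<close>. The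
    choice depends only on \<open>K\<close> and \<open>\<epsilon>\<close>, so one instance defeats
    all \<open>\<tau>\<close>.\<close>
  obtain N' :: nat where N': "2 * real K / (1 - \<epsilon>) < real N'"
    using reals_Archimedean2 by blast
  define N where "N = N' + 2"
  have N: "2 \<le> N" and "2 * real K / (1 - \<epsilon>) < real N"
    using N' by (auto simp: N_def)
  then have KN: "2 * real K < (1 - \<epsilon>) * real N"
    using assms by (simp add: field_simps)
  let ?F = "geometric_instance N"
  have inst: "correlated_prophet_instance 2 ?F"
    by (rule correlated_prophet_instance_geometric[OF N])
  moreover have "ereal M \<le> ereal_of_enat (competition_complexity \<epsilon> 2 ?F (block_threshold_alg 2 \<tau>))"
    for \<tau>
  proof -
    have "(\<integral>v. block_threshold_alg 2 \<tau> K v \<partial>iid_copies K ?F)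
        \<le> real K * ((1 - 1 / real N) * (2 * real N))"
      using inst expectation_block_select_geometric_le[OF N] integrable_block_select_geometric[OF N]
      by (intro expectation_block_threshold_alg_le) (auto simp: correlated_prophet_instance_def)
    also have "\<dots> = (2 * real K) * ((1 - 1 / real N) * real N)"
      by (simp add: mult_ac)
    also have "\<dots> < ((1 - \<epsilon>) * real N) * ((1 - 1 / real N) * real N)"
      \<comment> \<open>Strictness survives because \<open>2 \<le> N\<close> makes the common factor
        \<open>(1 - 1/N) * N\<close> positive.\<close>
      using N KN by (intro mult_strict_right_mono) auto
    also have "\<dots> = (1 - \<epsilon>) * (\<integral>v. Max (v ` {..<2}) \<partial>?F)"
      by (simp add: expectation_Max_geometric_instance[OF N] power2_eq_square mult_ac)
    finally have "enat K \<le> competition_complexity \<epsilon> 2 ?F (block_threshold_alg 2 \<tau>)"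
      by (rule competition_complexity_ge)
    then have "ereal (real K) \<le> ereal_of_enat (competition_complexity \<epsilon> 2 ?F (block_threshold_alg 2 \<tau>))"
      by (metis ereal_of_enat_le_iff ereal_of_enat_simps(1))
    with K show ?thesis
      by (meson ereal_less_eq(3) order_trans)
  qed
  ultimately show ?thesis by blast
qed

end
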